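(* Let $T=(P,B)$ be a template of length $t$ such that the binary string $B$ contains exactly $k$ zeros, and let $\sigma$ be a pattern (permutation) of length $l>0$. If there exists $n$ such that $R_{n,T}$ contains a permutation containing $\sigma$ as a pattern, then there exists $m\le (l-1)(k+1)+1$ such that $R_{m,T}$ contains a permutation containing $\sigma$ as a pattern.
   Context: A permutation $\pi$ contains a pattern $\sigma$ if some subsequence of $\pi$ is order-isomorphic to $\sigma$. A template of length $t\ge1$ is a pair $T=(P,B)$ where $P=p_1\cdots p_t$ is a permutation of $\{1,\dots,t\}$ and $B=b_1\cdots b_t$ is a binary string of length $t$. The sets $R_{n,T}$ of permutations of length $n$ are defined recursively: $R_{0,T}$ consists of the empty permutation and $R_{1,T}=\{1\}$; for $n\ge 2$, $R_{n,T}$ is the set of permutations $\pi$ of length $n$ that can be divided into consecutive (possibly empty) subwords $W_1,\dots,W_t$ (so $\pi$ is the concatenation $W_1W_2\cdots W_t$) such that: whenever $p_i>p_j$, every entry of $W_i$ is greater than every entry of $W_j$; each $W_i$ of length $l$, viewed up to order-isomorphism (i.e. standardized to a permutation of $\{1,\dots,l\}$), is an element of $R_{l,T}$; and whenever $b_i=0$, $W_i$ has exactly one element. *)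

theory Defs
  imports Main "HOL-Library.Sublist"
begin

text \<open>Permutations of length \<open>n\<close> are words (one-line notation) over \<open>{1..n}\<close>.\<close>

definition is_perm :: "nat \<Rightarrow> nat list \<Rightarrow> bool" where
  "is_perm n \<pi> \<longleftrightarrow> length \<pi> = n \<and> distinct \<pi> \<and> set \<pi> = {1..n}"

definition order_iso :: "nat list \<Rightarrow> nat list \<Rightarrow> bool" where
  "order_iso u v \<longleftrightarrow> length u = length v \<and>
     (\<forall>i<length u. \<forall>j<length u. u ! i < u ! j \<longleftrightarrow> v ! i < v ! j)"

definition contains_pattern :: "nat list \<Rightarrow> nat list \<Rightarrow> bool" where
  "contains_pattern \<pi> \<sigma> \<longleftrightarrow> (\<exists>w. subseq w \<pi> \<and> order_iso w \<sigma>)"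

definition standardize :: "nat list \<Rightarrow> nat list" where
  "standardize w = map (\<lambda>x. card {y \<in> set w. y \<le> x}) w"

type_synonym template = "nat list \<times> nat list"

definition is_template :: "nat \<Rightarrow> template \<Rightarrow> bool" where
  "is_template t T \<longleftrightarrow> t \<ge> 1 \<and> is_perm t (fst T) \<and> length (snd T) = t \<and> set (snd T) \<subseteq> {0, 1}"

text \<open>
  If \<open>B\<close> has no zeros, a subword may be all of \<open>\<pi>\<close>, so the recursion is not well-founded in \<open>n\<close>.
  It is read as generating the sets, i.e. as a least fixed point.
\<close>

inductive in_R :: "template \<Rightarrow> nat \<Rightarrow> nat list \<Rightarrow> bool" for T :: template where
  in_R_empty: "in_R T 0 []"
| in_R_single: "in_R T 1 [1]"
| in_R_step: "\<lbrakk> n \<ge> 2; is_perm n \<pi>;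
     length W = length (fst T); concat W = \<pi>;
     \<forall>i<length (fst T). \<forall>j<length (fst T). fst T ! i > fst T ! j \<longrightarrow>
       (\<forall>x\<in>set (W ! i). \<forall>y\<in>set (W ! j). x > y);
     \<forall>i<length (fst T). in_R T (length (W ! i)) (standardize (W ! i));
     \<forall>i<length (fst T). snd T ! i = 0 \<longrightarrow> length (W ! i) = 1 \<rbrakk>
   \<Longrightarrow> in_R T n \<pi>"

definition R :: "nat \<Rightarrow> template \<Rightarrow> nat list set" where
  "R n T = {\<pi>. in_R T n \<pi>}"

lemma R_is_perm: "\<pi> \<in> R n T \<Longrightarrow> is_perm n \<pi>"
  unfolding R_def mem_Collect_eq by (cases rule: in_R.cases) (simp_all add: is_perm_def)

lemma rank_less:
  assumes "x \<in> set w" "y \<in> set w"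
  shows "card {z \<in> set w. z \<le> x} < card {z \<in> set w. z \<le> y} \<longleftrightarrow> x < (y::nat)"
proof
  assume "x < y"
  have "{z \<in> set w. z \<le> x} \<subset> {z \<in> set w. z \<le> y}"
    using assms \<open>x < y\<close> by force
  then show "card {z \<in> set w. z \<le> x} < card {z \<in> set w. z \<le> y}"
    by (intro psubset_card_mono) auto
next
  assume *: "card {z \<in> set w. z \<le> x} < card {z \<in> set w. z \<le> y}"
  show "x < y"
  proof (rule ccontr)
    assume "\<not> x < y"
    then have "card {z \<in> set w. z \<le> y} \<le> card {z \<in> set w. z \<le> x}"
      by (intro card_mono) auto
    with * show False by simp
  qed
qed

lemma order_iso_standardize: "order_iso (standardize w) w"
  by (auto simp: order_iso_def standardize_def rank_less)

lemma is_perm_standardize: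
  assumes "distinct w"
  shows "is_perm (length w) (standardize w)"
proof -
  have inj: "inj_on (\<lambda>x. card {y \<in> set w. y \<le> x}) (set w)"
  proof (rule inj_onI)
    fix x y
    assume "x \<in> set w" "y \<in> set w"
      and "card {z \<in> set w. z \<le> x} = card {z \<in> set w. z \<le> y}"
    then show "x = y"
      using rank_less[of x w y] rank_less[of y w x] by linarith
  qed
  have sub: "set (standardize w) \<subseteq> {1..length w}"
  proof
    fix r assume "r \<in> set (standardize w)"
    then obtain x where x: "x \<in> set w" "r = card {y \<in> set w. y \<le> x}"
      by (auto simp: standardize_def)
    have "{x} \<subseteq> {y \<in> set w. y \<le> x}" using x by auto
    then have "card {x} \<le> r" unfolding x(2) by (intro card_mono) auto
    moreover have "r \<le> card (set w)" unfolding x(2) by (intro card_mono) auto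
    ultimately show "r \<in> {1..length w}" using card_length[of w] by simp
  qed
  have dist: "distinct (standardize w)"
    using assms inj by (simp add: standardize_def distinct_map)
  have len: "length (standardize w) = length w" by (simp add: standardize_def)
  have "set (standardize w) = {1..length w}"
    using sub dist len by (intro card_subset_eq) (auto simp: distinct_card)
  with dist len show ?thesis by (simp add: is_perm_def)
qed

end

theory Submission
  imports Defs
begin

text \<open>
  An occurrence \<open>u\<close> of \<open>\<sigma>\<close> in \<open>\<pi> \<in> R n T\<close> can be completed, inside \<open>\<pi>\<close>, to a short
  subsequence whose standardization again lies in some \<open>R m T\<close>; this goes by induction on the
  generation of \<open>\<pi> = W\<^sub>1\<dots>W\<^sub>t\<close>. If \<open>u\<close> lies in one block, pass to that block. Otherwise \<open>u\<close>
  splits into pieces \<open>U\<^sub>i\<close>, at least two of them nonempty: complete each nonempty piece within its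
  block, keep the singleton blocks with \<open>b\<^sub>i = 0\<close>, and drop all other blocks. A nonempty piece
  costs at most \<open>(k + 1) \<bar>U\<^sub>i\<bar> - k\<close> entries and the blocks with \<open>b\<^sub>i = 0\<close> at most \<open>k\<close> more, so
  two nonempty pieces already give the total \<open>(k + 1) \<bar>u\<bar> - k\<close>.
\<close>

text \<open>A strictly monotone relabelling preserves ranks: \<open>f\<close> maps the entries at
  most \<open>x\<close> bijectively onto the image entries at most \<open>f x\<close>.\<close>

lemma standardize_map_strict_mono:
  assumes "strict_mono_on (set w) f"
  shows "standardize (map f w) = standardize w"
proof -
  have "card {y \<in> f ` set w. y \<le> f x} = card {y \<in> set w. y \<le> x}" if "x \<in> set w" for x
  proof -
    have "{y \<in> f ` set w. y \<le> f x} = f ` {y \<in> set w. y \<le> x}"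
      using that assms by (auto simp: strict_mono_on_less_eq)
    moreover have "inj_on f {y \<in> set w. y \<le> x}"
      using strict_mono_on_imp_inj_on[OF assms] by (rule inj_on_subset) auto
    ultimately show ?thesis by (simp add: card_image)
  qed
  then show ?thesis by (simp add: standardize_def)
qed

text \<open>Hides the rank function behind an arbitrary strictly monotone \<open>f\<close>; later
  arguments about standardizations rely on this monotonicity instead of on cardinalities.\<close>

lemma standardize_eq_map:
  obtains f where "strict_mono_on (set w) f" "standardize w = map f w"
  by (rule that[of "\<lambda>x. card {y \<in> set w. y \<le> x}"])
    (auto simp: strict_mono_on_def rank_less standardize_def)

lemma length_standardize [simp]: "length (standardize w) = length w"
  by (simp add: standardize_def)

lemma order_iso_trans: "order_iso u v \<Longrightarrow> order_iso v w \<Longrightarrow> order_iso u w"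
  by (simp add: order_iso_def)

lemma order_iso_map_strict_mono:
  "strict_mono_on (set w) f \<Longrightarrow> order_iso (map f w) w"
  by (auto simp: order_iso_def strict_mono_on_less)

lemma set_subseq_subset: "subseq u v \<Longrightarrow> set u \<subseteq> set v"
  by (auto simp: subseq_conv_nths dest: in_set_nthsD)

lemma distinct_subseq: "subseq u v \<Longrightarrow> distinct v \<Longrightarrow> distinct u"
  by (auto simp: subseq_conv_nths)

lemma subseq_concatE:
  assumes "subseq u (concat W)"
  obtains U where "u = concat U" "list_all2 subseq U W"
  using assms
proof (induction W arbitrary: u thesis)
  case Nil
  then show ?case by (auto intro: Nil(1)[of "[]"])
next
  case (Cons w W)
  from Cons.prems(2) obtain x y where "u = x @ y" "subseq x w" "subseq y (concat W)"
    by (auto simp: subseq_append_iff)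
  moreover from Cons.IH[OF _ this(3)] obtain U where "y = concat U" "list_all2 subseq U W"
    by metis
  ultimately show ?case by (auto intro: Cons.prems(1)[of "x # U"])
qed

lemma subseq_concat_mono:
  "list_all2 subseq V W \<Longrightarrow> subseq (concat V) (concat W)"
  by (induction rule: list_all2_induct) (auto intro: list_emb_append_mono)

text \<open>Applied in contrapositive form: an occurrence that fits into no single block has a
  second nonempty piece.\<close>

lemma concat_eq_nth:
  assumes "i < length U" "\<And>j. j < length U \<Longrightarrow> j \<noteq> i \<Longrightarrow> U ! j = []"
  shows "concat U = U ! i"
proof -
  have "concat (take i U) = []"
    using assms by (auto simp: in_set_conv_nth)
  moreover have "concat (drop (Suc i) U) = []"
    using assms by (auto simp: in_set_conv_nth)
  ultimately show ?thesis
    using id_take_nth_drop[OF assms(1)]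
    by (metis append_Nil append_Nil2 concat.simps(2) concat_append)
qed

lemma length_concat_nth: "length (concat U) = (\<Sum>i<length U. length (U ! i))"
  by (simp add: length_concat sum_list_sum_nth atLeast0LessThan)

lemma count_list_eq_sum: "count_list xs x = (\<Sum>i<length xs. if xs ! i = x then 1 else 0)"
  by (induction xs) (simp_all add: sum.lessThan_Suc_shift del: sum.lessThan_Suc)

text \<open>Here \<open>a\<close> and \<open>b\<close> will be the lengths of the completed and the
  original pieces, \<open>c\<close> marks the positions with bit 0, and \<open>d\<close> the
  nonempty pieces. Summing the inequalities saves \<open>k\<close> for each index with
  \<open>d\<close>. Of the two savings from \<open>i\<close> and \<open>j\<close>, one pays for the
  sum of \<open>c\<close> and the other remains in the conclusion.\<close>

lemma sum_length_bound:
  fixes a b c :: "nat \<Rightarrow> nat" and d :: "nat \<Rightarrow> bool"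
  assumes each: "\<And>h. h < t \<Longrightarrow> a h + k * (if d h then 1 else 0) \<le> (k + 1) * b h + c h"
    and c: "(\<Sum>h<t. c h) \<le> k"
    and ij: "i < t" "j < t" "i \<noteq> j" "d i" "d j"
  shows "(\<Sum>h<t. a h) + k \<le> (k + 1) * (\<Sum>h<t. b h)"
proof -
  have "(\<Sum>h\<in>{i,j}. (if d h then 1 else 0)) \<le> (\<Sum>h<t. (if d h then 1 else (0::nat)))"
    using ij by (intro sum_mono2) auto
  then have two: "2 \<le> (\<Sum>h<t. (if d h then 1 else (0::nat)))"
    using ij by simp
  have "(\<Sum>h<t. a h) + k * 2 \<le> (\<Sum>h<t. a h) + k * (\<Sum>h<t. (if d h then 1 else 0))"
    using mult_le_mono2[OF two, of k] by simp
  also have "\<dots> = (\<Sum>h<t. a h + k * (if d h then 1 else 0))"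
    by (simp add: sum.distrib sum_distrib_left)
  also have "\<dots> \<le> (\<Sum>h<t. (k + 1) * b h + c h)"
    using each by (intro sum_mono) auto
  also have "\<dots> = (k + 1) * (\<Sum>h<t. b h) + (\<Sum>h<t. c h)"
    by (simp only: sum.distrib sum_distrib_left)
  also note c
  finally show ?thesis by simp
qed

text \<open>A single rank map \<open>f\<close> of the whole word relabels all blocks at once. The
  words \<open>map f (V ! i)\<close> divide the standardization; they inherit the order between
  blocks and have the same standardizations as the \<open>V ! i\<close>.\<close>

lemma in_R_standardize_concat:
  assumes "distinct (concat V)" "length (concat V) \<ge> 2" "length V = length (fst T)"
    and ord: "\<And>i j x y. \<lbrakk>i < length V; j < length V; fst T ! i > fst T ! j;
        x \<in> set (V ! i); y \<in> set (V ! j)\<rbrakk> \<Longrightarrow> x > y"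
    and R: "\<And>i. i < length V \<Longrightarrow> in_R T (length (V ! i)) (standardize (V ! i))"
    and zero: "\<And>i. i < length V \<Longrightarrow> snd T ! i = 0 \<Longrightarrow> length (V ! i) = 1"
  shows "in_R T (length (concat V)) (standardize (concat V))"
proof -
  obtain f where mono: "strict_mono_on (set (concat V)) f"
    and f: "standardize (concat V) = map f (concat V)"
    by (rule standardize_eq_map)
  have sub: "set (V ! i) \<subseteq> set (concat V)" if "i < length V" for i
    using nth_mem[OF that] by auto
  have st: "standardize (map f (V ! i)) = standardize (V ! i)" if "i < length V" for i
    by (rule standardize_map_strict_mono[OF monotone_on_subset[OF mono sub[OF that]]])
  show ?thesis
  proof (rule in_R_step[where W = "map (map f) V"])
    show "is_perm (length (concat V)) (standardize (concat V))"
      by (rule is_perm_standardize) fact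
    show "concat (map (map f) V) = standardize (concat V)"
      by (simp add: f map_concat)
    show "\<forall>i<length (fst T). \<forall>j<length (fst T). fst T ! j < fst T ! i \<longrightarrow>
       (\<forall>x\<in>set (map (map f) V ! i). \<forall>y\<in>set (map (map f) V ! j). y < x)"
    proof (intro allI impI ballI)
      fix i j x y
      assume *: "i < length (fst T)" "j < length (fst T)" "fst T ! j < fst T ! i"
        "x \<in> set (map (map f) V ! i)" "y \<in> set (map (map f) V ! j)"
      then obtain x' y' where "x = f x'" "y = f y'" "x' \<in> set (V ! i)" "y' \<in> set (V ! j)"
        using assms(3) by auto
      moreover from this have "y' < x'" "x' \<in> set (concat V)" "y' \<in> set (concat V)"
        using * ord[of i j x' y'] sub[of i] sub[of j] assms(3) by auto
      ultimately show "y < x"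
        using strict_mono_onD[OF mono] by blast
    qed
  qed (use assms st in auto)
qed

text \<open>The bound is \<open>(k + 1) * (length u - 1) + 1\<close> written without subtraction;
  one entry attains it. Completing the given occurrence \<open>u\<close> inside \<pi> itself, rather
  than finding some copy of the pattern, keeps the completions of different pieces in their blocks,
  so that they can be concatenated.\<close>

lemma in_R_short_completion:
  assumes "in_R T n \<pi>" "length (snd T) = length (fst T)" "count_list (snd T) 0 = k"
    and "subseq u \<pi>" "u \<noteq> []"
  shows "\<exists>v. subseq u v \<and> subseq v \<pi> \<and> in_R T (length v) (standardize v) \<and>
           length v + k \<le> (k + 1) * length u"
  using assms
proof (induction arbitrary: u rule: in_R.induct)
  case in_R_empty
  then show ?case by simp
next
  case in_R_single
  from in_R_single(3,4) have "u = [1]"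
    by (cases u) (auto simp: list_emb_Cons_iff1 split: if_splits)
  moreover have "standardize [1] = [1]"
    by (simp add: standardize_def Collect_conv_if)
  ultimately show ?case
    using in_R.in_R_single[of T] by (intro exI[of _ "[1]"]) simp
next
  case (in_R_step n \<pi> W)
  define t where "t = length (fst T)"
  have len: "length W = t" and dist: "distinct (concat W)"
    using in_R_step.hyps by (auto simp: t_def is_perm_def)
  have RW: "in_R T (length (W ! i)) (standardize (W ! i))" if "i < t" for i
    using in_R_step.IH that by (simp add: t_def)
  have IH: "\<exists>v. subseq u v \<and> subseq v (W ! i) \<and> in_R T (length v) (standardize v) \<and>
      length v + k \<le> (k + 1) * length u"
    if i: "i < t" and u: "subseq u (W ! i)" "u \<noteq> []" for i u
  proof -
    obtain f where mono: "strict_mono_on (set (W ! i)) f"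
      and f: "standardize (W ! i) = map f (W ! i)"
      by (rule standardize_eq_map)
    have IH: "\<lbrakk>subseq x (standardize (W ! i)); x \<noteq> []\<rbrakk> \<Longrightarrow> \<exists>v. subseq x v \<and>
        subseq v (standardize (W ! i)) \<and> in_R T (length v) (standardize v) \<and>
        length v + k \<le> (k + 1) * length x" for x
      using in_R_step.IH[rule_format, of i] i in_R_step.prems(1,2) unfolding t_def by blast
    \<comment> \<open>The induction hypothesis concerns the standardized block. The inverse
      \<open>g\<close> of its relabelling carries the completion back to the block, and by
      monotonicity of \<open>f\<close> the standardization stays the same.\<close>
    define g where "g = inv_into (set (W ! i)) f"
    have gf: "map g (map f x) = x" if "subseq x (W ! i)" for x
      using strict_mono_on_imp_inj_on[OF mono] set_subseq_subset[OF that]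
      by (auto simp: g_def intro!: map_idI)
    have "subseq (map f u) (standardize (W ! i))"
      unfolding f by (rule subseq_map) fact
    then obtain v where v: "subseq (map f u) v" "subseq v (map f (W ! i))"
        "in_R T (length v) (standardize v)" "length v + k \<le> (k + 1) * length u"
      using IH[of "map f u"] u(2) by (auto simp: f)
    have uv: "subseq u (map g v)"
      using subseq_map[OF v(1), of g] gf[OF u(1)] by simp
    have vW: "subseq (map g v) (W ! i)"
      using subseq_map[OF v(2), of g] gf[of "W ! i"] by simp
    have "set v \<subseteq> f ` set (W ! i)"
      using set_subseq_subset[OF v(2)] by auto
    then have "map f (map g v) = v"
      by (auto simp: g_def f_inv_into_f intro!: map_idI)
    moreover have "strict_mono_on (set (map g v)) f"
      using mono set_subseq_subset[OF vW] by (rule monotone_on_subset)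
    ultimately have "standardize (map g v) = standardize v"
      using standardize_map_strict_mono by metis
    with uv vW v(3,4) show ?thesis by (intro exI[of _ "map g v"]) simp
  qed
  have subW: "subseq (W ! i) \<pi>" if "i < t" for i
  proof -
    have "concat W = concat (take i W) @ W ! i @ concat (drop (Suc i) W)"
      using that len id_take_nth_drop[of i W] by (metis concat.simps(2) concat_append)
    then show ?thesis
      using in_R_step.hyps by (auto intro: subseq_drop_many subseq_rev_drop_many)
  qed
  show ?case
  \<comment> \<open>With a single nonempty piece the summation would save \<open>k\<close> only
    once, so this case takes the completion within the block directly.\<close>
  proof (cases "\<exists>i<t. subseq u (W ! i)")
    case True
    then show ?thesis
      using IH in_R_step.prems(4) subW by (meson subseq_order.trans)
  next
    case False
    from in_R_step.prems(3) in_R_step.hyps obtain U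
      where U: "u = concat U" "list_all2 subseq U W"
      using subseq_concatE by metis
    have lU: "length U = t" using U(2) len by (simp add: list_all2_lengthD)
    have UW: "subseq (U ! i) (W ! i)" if "i < t" for i
      using U(2) that lU by (simp add: list_all2_nthD)
    obtain i where i: "i < t" "U ! i \<noteq> []"
      using in_R_step.prems(4) U(1) lU by (auto simp: in_set_conv_nth)
    \<comment> \<open>If all other pieces were empty, \<open>u\<close> would equal
      \<open>U ! i\<close> and lie in the block \<open>W ! i\<close>.\<close>
    obtain j where j: "j < t" "j \<noteq> i" "U ! j \<noteq> []"
      using concat_eq_nth[of i U] i lU U(1) UW[OF i(1)] False by metis
    \<comment> \<open>The term with \<open>k\<close> on the left is the saving of a nonempty piece.
      The extra 1 on the right pays for a block with bit 0, which has to keep its entry even where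
      \<open>u\<close> avoids it.\<close>
    define good where "good h v \<longleftrightarrow> subseq (U ! h) v \<and> subseq v (W ! h) \<and>
        in_R T (length v) (standardize v) \<and> (snd T ! h = 0 \<longrightarrow> length v = 1) \<and>
        length v + k * (if U ! h \<noteq> [] then 1 else 0)
          \<le> (k + 1) * length (U ! h) + (if snd T ! h = 0 then 1 else 0)" for h v
    have "\<exists>v. good h v"
      if h: "h < t" for h
    proof (cases "snd T ! h = 0")
      case True
      then have "length (W ! h) = 1" using in_R_step.hyps(6) h by (simp add: t_def)
      moreover have "k \<le> (k + 1) * length (U ! h)" if "U ! h \<noteq> []"
        using that by (cases "U ! h") auto
      ultimately show ?thesis
        using UW[OF h] RW[OF h] True unfolding good_def by (intro exI[of _ "W ! h"]) auto
    next
      case False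
      show ?thesis
      proof (cases "U ! h = []")
        case True
        then show ?thesis
          using False in_R_empty[of T] by (intro exI[of _ "[]"]) (simp add: good_def standardize_def)
      next
        case nonempty: False
        then show ?thesis using IH[OF h UW[OF h]] False by (simp add: good_def)
      qed
    qed
    then obtain V where "\<And>h. h < t \<Longrightarrow> good h (V h)" by metis
    then have V: "\<And>h. h < t \<Longrightarrow> subseq (U ! h) (V h)"
        "\<And>h. h < t \<Longrightarrow> subseq (V h) (W ! h)"
        "\<And>h. h < t \<Longrightarrow> in_R T (length (V h)) (standardize (V h))"
        "\<And>h. h < t \<Longrightarrow> snd T ! h = 0 \<Longrightarrow> length (V h) = 1"
        "\<And>h. h < t \<Longrightarrow> length (V h) + k * (if U ! h \<noteq> [] then 1 else 0)
          \<le> (k + 1) * length (U ! h) + (if snd T ! h = 0 then 1 else 0)"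
      unfolding good_def by blast+
    define Vs where "Vs = map V [0..<t]"
    have Vs: "length Vs = t" "\<And>h. h < t \<Longrightarrow> Vs ! h = V h" by (simp_all add: Vs_def)
    have uV: "subseq u (concat Vs)"
      unfolding U(1) using V(1) Vs lU
      by (intro subseq_concat_mono) (simp add: list_all2_conv_all_nth)
    have VW: "subseq (concat Vs) (concat W)"
      using V(2) Vs len by (intro subseq_concat_mono) (simp add: list_all2_conv_all_nth)
    have bound: "length (concat Vs) + k \<le> (k + 1) * length u"
    proof -
      have "(\<Sum>h<t. length (V h)) + k \<le> (k + 1) * (\<Sum>h<t. length (U ! h))"
      proof (rule sum_length_bound[where d = "\<lambda>h. U ! h \<noteq> []" and i = i and j = j])
        show "(\<Sum>h<t. if snd T ! h = 0 then 1 else 0) \<le> k"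
          using in_R_step.prems(1,2) by (simp add: t_def count_list_eq_sum)
      qed (fact V(5) i j j(2)[symmetric])+
      then show ?thesis by (simp add: length_concat_nth U(1) lU Vs)
    qed
    \<comment> \<open>The rule \<open>in_R_step\<close> only builds words of length at least 2; the
      two nonempty pieces guarantee this.\<close>
    have "2 \<le> length u"
    proof -
      have "(\<Sum>h\<in>{i,j}. length (U ! h)) \<le> length u"
        unfolding U(1) length_concat_nth using i j lU by (intro sum_mono2) auto
      moreover have "length (U ! i) \<ge> 1" "length (U ! j) \<ge> 1"
        using i j by (simp_all add: Suc_le_eq)
      ultimately show ?thesis using j(2) by simp
    qed
    then have two: "2 \<le> length (concat Vs)"
      using list_emb_length[OF uV] by simp
    have "in_R T (length (concat Vs)) (standardize (concat Vs))"
    proof (rule in_R_standardize_concat)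
      show "distinct (concat Vs)" using VW dist by (rule distinct_subseq)
      fix i j x y
      assume *: "i < length Vs" "j < length Vs" "fst T ! j < fst T ! i"
        "x \<in> set (Vs ! i)" "y \<in> set (Vs ! j)"
      then have "x \<in> set (W ! i)" "y \<in> set (W ! j)"
        using set_subseq_subset[OF V(2)[of i]] set_subseq_subset[OF V(2)[of j]] Vs by auto
      moreover have "i < length (fst T)" "j < length (fst T)" using * Vs(1) t_def by auto
      ultimately show "y < x" using in_R_step.hyps(5) *(3) by blast
    qed (simp_all add: two Vs V flip: t_def length_concat)
    then show ?thesis using uV VW bound in_R_step.hyps(4) by blast
  qed
qed

theorem theorem5:
  fixes T :: template and t k l :: nat and \<sigma> :: "nat list"
  assumes "is_template t T"
    and "count_list (snd T) 0 = k"
    and "is_perm l \<sigma>" and "l > 0"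
    and "\<exists>n. \<exists>\<pi>\<in>R n T. contains_pattern \<pi> \<sigma>"
  shows "\<exists>m \<le> (l - 1) * (k + 1) + 1. \<exists>\<pi>\<in>R m T. contains_pattern \<pi> \<sigma>"
proof -
  from assms(5) obtain n \<pi> u where u: "in_R T n \<pi>" "subseq u \<pi>" "order_iso u \<sigma>"
    by (auto simp: R_def contains_pattern_def)
  have lu: "length u = l"
    using u(3) assms(3) by (simp add: order_iso_def is_perm_def)
  have "length (snd T) = length (fst T)"
    using assms(1) by (simp add: is_template_def is_perm_def)
  moreover have "u \<noteq> []" using lu assms(4) by auto
  ultimately obtain v where v: "subseq u v" "in_R T (length v) (standardize v)"
      "length v + k \<le> (k + 1) * l"
    using in_R_short_completion[OF u(1) _ assms(2) u(2)] lu by auto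
  obtain f where f: "strict_mono_on (set v) f" "standardize v = map f v"
    by (rule standardize_eq_map)
  \<comment> \<open>The map that standardizes \<open>v\<close> is monotone on \<open>u\<close> as
    well, so \<open>map f u\<close> is an occurrence of \<sigma> in
    \<open>standardize v\<close>.\<close>
  have "strict_mono_on (set u) f"
    using f(1) set_subseq_subset[OF v(1)] by (rule monotone_on_subset)
  then have "order_iso (map f u) \<sigma>"
    using order_iso_map_strict_mono order_iso_trans u(3) by blast
  then have "contains_pattern (standardize v) \<sigma>"
    unfolding contains_pattern_def f(2) using subseq_map[OF v(1)] by blast
  moreover have "length v \<le> (l - 1) * (k + 1) + 1"
    using v(3) assms(4) by (cases l) (auto simp: algebra_simps)
  ultimately show ?thesis using v(2) by (auto simp: R_def)
qed

end
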